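(* Let $\bar x\in\mathbb{R}^n$ and let $X:\mathbb{R}^n\to\mathbb{R}^n$ be a locally Lipschitz continuous vector field such that $X(\bar x)=0$ and $\langle x-\bar x,X(x)\rangle>0$ for all $x\in\mathbb{R}^n\setminus\{\bar x\}$. Let $\kappa_1,\kappa_2>0$, $\alpha_1\in(0,1)$, $\alpha_2>1$, and consider the autonomous differential equation $$\dot x(t)=-\sigma(x(t))X(x(t)),\qquad \sigma(x)=\begin{cases}0,& X(x)=0,\\ \kappa_1\dfrac{1}{\|X(x)\|^{1-\alpha_1}}+\kappa_2\dfrac{1}{\|X(x)\|^{1-\alpha_2}},&\text{otherwise.}\end{cases}$$ Then the right-hand side $x\mapsto-\sigma(x)X(x)$ is continuous for all $x\in\mathbb{R}^n$, and starting from any given initial condition $x(0)\in\mathbb{R}^n$, a solution of the differential equation exists and is uniquely determined for all $t\ge 0$.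
   Context: $\mathbb{R}^n$ carries an inner product $\langle\cdot,\cdot\rangle$ with induced norm $\|\cdot\|$. *)

theory Defs
  imports "HOL-Analysis.Analysis"
begin

text \<open>
  The state-dependent factor that scales the vector field. The exponents \<open>1 - \<alpha>\<^sub>1\<close> and \<open>1 - \<alpha>\<^sub>2\<close> are real (the second one is negative), hence \<open>powr\<close>.
\<close>

definition gain ::
    "real \<Rightarrow> real \<Rightarrow> real \<Rightarrow> real \<Rightarrow> ('a::euclidean_space \<Rightarrow> 'a) \<Rightarrow> 'a \<Rightarrow> real" where
  "gain \<kappa>\<^sub>1 \<kappa>\<^sub>2 \<alpha>\<^sub>1 \<alpha>\<^sub>2 X x =
     (if X x = 0 then 0
      else \<kappa>\<^sub>1 * (1 / norm (X x) powr (1 - \<alpha>\<^sub>1)) + \<kappa>\<^sub>2 * (1 / norm (X x) powr (1 - \<alpha>\<^sub>2)))"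

text \<open>
  Classical solutions on \<open>[0, \<infinity>)\<close> of the autonomous initial value problem \<open>x' = F x\<close>,
  \<open>x 0 = x\<^sub>0\<close>, with a one-sided derivative at \<open>0\<close>. The values of \<open>x\<close> at negative times are
  irrelevant, so two solutions can only be compared on \<open>{0..}\<close>.
\<close>

definition ivp_solution :: "('a::real_normed_vector \<Rightarrow> 'a) \<Rightarrow> 'a \<Rightarrow> (real \<Rightarrow> 'a) \<Rightarrow> bool" where
  "ivp_solution F x\<^sub>0 x \<longleftrightarrow>
     x 0 = x\<^sub>0 \<and> (\<forall>t\<ge>0. (x has_vector_derivative F (x t)) (at t within {0..}))"

end

theory Submission
  imports Defs "HOL-Complex_Analysis.Great_Picard"
begin

text \<open>
  The right-hand side is \<open>F x = - (\<kappa>\<^sub>1 \<parallel>X x\<parallel>\<^bsup>\<alpha>\<^sub>1 - 1\<^esup> X x + \<kappa>\<^sub>2 \<parallel>X x\<parallel>\<^bsup>\<alpha>\<^sub>2 - 1\<^esup> X x)\<close>. The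
  map \<open>v \<mapsto> \<parallel>v\<parallel>\<^bsup>\<alpha> - 1\<^esup> v\<close> has norm \<open>\<parallel>v\<parallel>\<^bsup>\<alpha>\<^esup>\<close>, hence is continuous even at \<open>0\<close>, but it is locally
  Lipschitz only away from \<open>0\<close> when \<open>\<alpha> < 1\<close>. Since \<open>X\<close> vanishes only at \<open>xbar\<close>, the field \<open>F\<close> is continuous
  everywhere and locally Lipschitz except possibly at the single point \<open>xbar\<close>.

  What makes up for the missing Lipschitz condition is dissipativity: \<open>inner (x - xbar) (F x) \<le> 0\<close>,
  so the distance to \<open>xbar\<close> never increases along a solution
  (\<open>dissipative_distance_decreasing\<close>). This has two consequences.

  \<^item> Uniqueness (\<open>dissipative_solutions_unique\<close>). Look at the last time at which two solutions agree.
    If their common value there is \<open>xbar\<close>, both are trapped at \<open>xbar\<close> forever; otherwise \<open>F\<close> is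
    Lipschitz near that value, and a Gronwall estimate makes them agree for a while longer.

  \<^item> Global existence (\<open>dissipative_solution_exists\<close>). Solutions cannot leave the ball in which they
    start, so \<open>F\<close> may be replaced by a bounded continuous field that equals \<open>F\<close> on this ball. Such a
    field has solutions on every \<open>[0, T]\<close> by Peano's theorem (\<open>bounded_peano\<close>). A contraction
    argument is not enough, since a trajectory may reach \<open>xbar\<close> in finite time. Uniqueness lets
    the solutions on \<open>[0, n]\<close> be glued to one on \<open>[0, \<infinity>)\<close>.
\<close>

section \<open>Growth of the distance along trajectories\<close>

text \<open>
  The function \<open>exp (- 2 L t) \<parallel>u t\<parallel>\<^sup>2\<close> is nonincreasing. For \<open>L = 0\<close> this is the decay of the
  distance to the equilibrium; for a Lipschitz constant \<open>L\<close> and a difference \<open>u\<close> of two solutions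
  it is uniqueness.
\<close>

lemma sq_norm_gronwall:
  fixes u u' :: "real \<Rightarrow> 'a::euclidean_space"
  assumes "a \<le> b"
    and deriv: "\<And>t. t \<in> {a..b} \<Longrightarrow> (u has_vector_derivative u' t) (at t within {a..b})"
    and growth: "\<And>t. t \<in> {a..b} \<Longrightarrow> inner (u t) (u' t) \<le> L * (norm (u t))\<^sup>2"
  shows "(norm (u b))\<^sup>2 \<le> exp (2 * L * (b - a)) * (norm (u a))\<^sup>2"
proof -
  define w where "w t = exp (- 2 * L * (t - a)) * inner (u t) (u t)" for t
  have cont_u: "continuous_on {a..b} u"
    using deriv continuous_on_vector_derivative by blast
  have "w b \<le> w a"
  proof (rule DERIV_nonpos_imp_decreasing_open[OF \<open>a \<le> b\<close>])
    show "continuous_on {a..b} w"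
      unfolding w_def by (intro continuous_intros cont_u)
    fix t assume t: "a < t" "t < b"
    have du: "(u has_vector_derivative u' t) (at t)"
      using deriv[of t] t by (simp add: at_within_Icc_at)
    have di: "((\<lambda>s. inner (u s) (u s)) has_real_derivative 2 * inner (u t) (u' t)) (at t)"
      using has_derivative_inner[OF du[unfolded has_vector_derivative_def] du[unfolded has_vector_derivative_def]]
      by (auto simp: has_field_derivative_def inner_commute algebra_simps
          elim!: has_derivative_eq_rhs)
    have dw: "(w has_real_derivative
        exp (- 2 * L * (t - a)) * (2 * inner (u t) (u' t) - 2 * L * inner (u t) (u t))) (at t)"
      unfolding w_def by (auto intro!: derivative_eq_intros di simp: algebra_simps)
    have "inner (u t) (u' t) \<le> L * inner (u t) (u t)"
      using growth[of t] t by (simp add: power2_norm_eq_inner)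
    then have "exp (- 2 * L * (t - a)) * (2 * inner (u t) (u' t) - 2 * L * inner (u t) (u t)) \<le> 0"
      by (intro mult_nonneg_nonpos) auto
    with dw show "\<exists>y. (w has_real_derivative y) (at t) \<and> y \<le> 0" by blast
  qed
  then have "exp (2 * L * (b - a)) * w b \<le> exp (2 * L * (b - a)) * w a"
    by (intro mult_left_mono) simp_all
  moreover have "exp (2 * L * (b - a)) * w b = (norm (u b))\<^sup>2"
    by (simp add: w_def power2_norm_eq_inner mult.assoc[symmetric] exp_add[symmetric])
  moreover have "w a = (norm (u a))\<^sup>2"
    by (simp add: w_def power2_norm_eq_inner)
  ultimately show ?thesis by simp
qed

definition solves_on :: "('a::real_normed_vector \<Rightarrow> 'a) \<Rightarrow> real \<Rightarrow> real \<Rightarrow> (real \<Rightarrow> 'a) \<Rightarrow> bool" where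
  "solves_on F a b x \<longleftrightarrow> (\<forall>t\<in>{a..b}. (x has_vector_derivative F (x t)) (at t within {a..b}))"

lemma solves_on_subinterval:
  assumes "solves_on F a b x" "a \<le> a'" "b' \<le> b"
  shows "solves_on F a' b' x"
  using assms unfolding solves_on_def
  by (auto intro!: has_vector_derivative_within_subset[where S = "{a..b}" and T = "{a'..b'}"])

lemma solves_on_continuous: "solves_on F a b x \<Longrightarrow> continuous_on {a..b} x"
  unfolding solves_on_def
  by (rule continuous_on_vector_derivative[where f' = "\<lambda>t. F (x t)"]) simp

text \<open>
  The field nowhere points away from \<open>c\<close>; equivalently, \<open>\<parallel>z - c\<parallel>\<^sup>2\<close> is a weak Lyapunov function.
\<close>

definition dissipative_about :: "'a::real_inner \<Rightarrow> ('a \<Rightarrow> 'a) \<Rightarrow> bool" where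
  "dissipative_about c F \<longleftrightarrow> (\<forall>z. inner (z - c) (F z) \<le> 0)"

lemma dissipative_distance_decreasing:
  fixes x :: "real \<Rightarrow> 'a::euclidean_space"
  assumes "dissipative_about c F" "solves_on F a b x" "a \<le> b"
  shows "norm (x b - c) \<le> norm (x a - c)"
proof -
  have "(norm (x b - c))\<^sup>2 \<le> exp (2 * 0 * (b - a)) * (norm (x a - c))\<^sup>2"
  proof (rule sq_norm_gronwall[OF \<open>a \<le> b\<close>])
    fix t assume t: "t \<in> {a..b}"
    show "((\<lambda>s. x s - c) has_vector_derivative F (x t)) (at t within {a..b})"
      using assms(2) t unfolding solves_on_def
      by (auto intro!: derivative_eq_intros)
    show "inner (x t - c) (F (x t)) \<le> 0 * (norm (x t - c))\<^sup>2"
      using assms(1) by (simp add: dissipative_about_def)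
  qed
  then show ?thesis by (simp add: power2_le_iff_abs_le)
qed

lemma lipschitz_solutions_agree:
  fixes x y :: "real \<Rightarrow> 'a::euclidean_space"
  assumes "L-lipschitz_on S F" "solves_on F a b x" "solves_on F a b y" "a \<le> b"
    and inS: "\<And>t. t \<in> {a..b} \<Longrightarrow> x t \<in> S \<and> y t \<in> S" and "x a = y a"
  shows "x b = y b"
proof -
  have "(norm (x b - y b))\<^sup>2 \<le> exp (2 * L * (b - a)) * (norm (x a - y a))\<^sup>2"
  proof (rule sq_norm_gronwall[OF \<open>a \<le> b\<close>])
    fix t assume t: "t \<in> {a..b}"
    show "((\<lambda>s. x s - y s) has_vector_derivative F (x t) - F (y t)) (at t within {a..b})"
      using assms(2,3) t unfolding solves_on_def
      by (auto intro!: derivative_eq_intros)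
    have "inner (x t - y t) (F (x t) - F (y t)) \<le> norm (x t - y t) * norm (F (x t) - F (y t))"
      by (rule norm_cauchy_schwarz)
    also have "\<dots> \<le> norm (x t - y t) * (L * norm (x t - y t))"
      using lipschitz_on_normD[OF assms(1), of "x t" "y t"] inS[OF t]
      by (intro mult_left_mono) auto
    finally show "inner (x t - y t) (F (x t) - F (y t)) \<le> L * (norm (x t - y t))\<^sup>2"
      by (simp add: power2_eq_square algebra_simps)
  qed
  with \<open>x a = y a\<close> show ?thesis by simp
qed

text \<open>
  Past the last time \<open>s\<close> of agreement before \<open>b\<close>, the solutions could only separate at a point near
  which no Lipschitz bound is assumed, that is at \<open>c\<close>; but a solution that has reached \<open>c\<close> has distance \<open>0\<close> to
  it and this distance cannot grow again.
\<close>

theorem dissipative_solutions_unique: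
  fixes x y :: "real \<Rightarrow> 'a::euclidean_space"
  assumes diss: "dissipative_about c F"
    and lip: "\<And>z. z \<noteq> c \<Longrightarrow> \<exists>\<delta>>0. \<exists>L. L-lipschitz_on (cball z \<delta>) F"
    and x: "solves_on F a b x" and y: "solves_on F a b y"
    and "a \<le> b" "x a = y a"
  shows "x b = y b"
proof (rule ccontr)
  assume ne: "x b \<noteq> y b"
  define A where "A = {t \<in> {a..b}. x t = y t}"
  have "closed A"
    unfolding A_def
    by (intro continuous_closed_preimage_constant[where a = 0 and f = "\<lambda>t. x t - y t", simplified]
        continuous_intros solves_on_continuous[OF x] solves_on_continuous[OF y])
  then have "compact A"
    by (rule compact_Int_closed[OF compact_Icc[of a b], THEN ssubst[of A _ compact, rotated]])
       (auto simp: A_def)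
  moreover have "a \<in> A" using assms by (simp add: A_def)
  ultimately obtain s where s: "s \<in> A" and last: "\<And>t. t \<in> A \<Longrightarrow> t \<le> s"
    using compact_attains_sup[of A] by blast
  have sab: "a \<le> s" "s < b" "x s = y s"
    using s ne by (auto simp: A_def less_le)
  show False
  proof (cases "x s = c")
    case True
    have "x b = c"
      using dissipative_distance_decreasing[OF diss solves_on_subinterval[OF x], of s b] sab True by simp
    moreover have "y b = c"
      using dissipative_distance_decreasing[OF diss solves_on_subinterval[OF y], of s b] sab True by simp
    ultimately show False using ne by simp
  next
    case False
    then obtain \<delta> L where \<delta>: "\<delta> > 0" and L: "L-lipschitz_on (cball (x s) \<delta>) F"
      using lip by blast
    have near: "\<exists>\<eta>>0. \<forall>t\<in>{a..b}. dist t s < \<eta> \<longrightarrow> dist (z t) (z s) < \<delta>"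
      if "solves_on F a b z" for z
      using solves_on_continuous[OF that] \<delta> sab unfolding continuous_on_iff by auto
    obtain \<eta>\<^sub>1 where \<eta>1: "\<eta>\<^sub>1 > 0" "\<And>t. t \<in> {a..b} \<Longrightarrow> dist t s < \<eta>\<^sub>1 \<Longrightarrow> dist (x t) (x s) < \<delta>"
      using near[OF x] by blast
    obtain \<eta>\<^sub>2 where \<eta>2: "\<eta>\<^sub>2 > 0" "\<And>t. t \<in> {a..b} \<Longrightarrow> dist t s < \<eta>\<^sub>2 \<Longrightarrow> dist (y t) (y s) < \<delta>"
      using near[OF y] by blast
    define r where "r = min b (s + min \<eta>\<^sub>1 \<eta>\<^sub>2 / 2)"
    have r: "s < r" "r \<le> b" "r - s < \<eta>\<^sub>1" "r - s < \<eta>\<^sub>2"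
      using \<eta>1(1) \<eta>2(1) sab by (auto simp: r_def min_def field_simps)
    have "x r = y r"
    proof (rule lipschitz_solutions_agree[OF L])
      show "solves_on F s r x" "solves_on F s r y"
        using solves_on_subinterval x y sab r by blast+
      show "x t \<in> cball (x s) \<delta> \<and> y t \<in> cball (x s) \<delta>" if "t \<in> {s..r}" for t
      proof -
        have "dist t s < \<eta>\<^sub>1" "dist t s < \<eta>\<^sub>2" "t \<in> {a..b}"
          using that r sab by (auto simp: dist_real_def)
        then show ?thesis
          using \<eta>1(2)[of t] \<eta>2(2)[of t] sab(3) by (simp add: dist_commute)
      qed
    qed (use r sab in auto)
    then have "r \<in> A" using r sab by (simp add: A_def)
    with last r show False by fastforce
  qed
qed

section \<open>Existence for bounded continuous fields\<close>

text \<open>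
  Tonelli's approximation: with a delay \<open>h\<close>, the integral equation determines \<open>u\<close> on \<open>[k h, (k + 1) h]\<close>
  from its values up to \<open>k h\<close>. Therefore iterating the integral operator \<open>\<Phi>\<close> from a constant function
  does not merely converge: the iterates are eventually stationary on any bounded interval. For \<open>t \<le> 0\<close> the integral over \<open>{0..t}\<close> is \<open>0\<close>, so the
  equation itself prescribes the constant history \<open>z\<^sub>0\<close>.
\<close>

lemma delayed_solution_exists:
  fixes G :: "'a::euclidean_space \<Rightarrow> 'a"
  assumes G: "continuous_on UNIV G" and M: "\<And>z. norm (G z) \<le> M" and "0 < h"
  shows "\<exists>u. (\<forall>s t. s \<le> t \<longrightarrow> norm (u t - u s) \<le> M * (t - s)) \<and>
             (\<forall>t\<le>T. u t = z\<^sub>0 + integral {0..t} (\<lambda>s. G (u (s - h))))"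
proof -
  define \<Phi> where "\<Phi> u t = z\<^sub>0 + integral {0..t} (\<lambda>s. G (u (s - h)))" for u :: "real \<Rightarrow> 'a" and t
  define U where "U k = (\<Phi> ^^ k) (\<lambda>_. z\<^sub>0)" for k
  have U_Suc: "U (Suc k) = \<Phi> (U k)" for k by (simp add: U_def)
  have "0 \<le> M" using M[of 0] norm_ge_zero order_trans by blast
  have \<Phi>_early: "\<Phi> u t = z\<^sub>0" if "t \<le> 0" for u t
    using that by (cases "t = 0") (auto simp: \<Phi>_def)
  have rate: "norm (\<Phi> u t - \<Phi> u s) \<le> M * (t - s)"
    if u: "continuous_on UNIV u" and "s \<le> t" for u s t
  proof -
    have cont: "continuous_on S (\<lambda>s. G (u (s - h)))" for S
      by (intro continuous_on_compose2[OF G continuous_on_compose2[OF u]] continuous_intros) auto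
    have pos: "norm (\<Phi> u t' - \<Phi> u s') \<le> M * (t' - s')" if "0 \<le> s'" "s' \<le> t'" for s' t'
    proof -
      have "\<Phi> u t' - \<Phi> u s' = integral {s'..t'} (\<lambda>s. G (u (s - h)))"
        using Henstock_Kurzweil_Integration.integral_combine
          [OF that integrable_continuous_real[OF cont]]
        by (simp add: \<Phi>_def algebra_simps)
      then show ?thesis
        using integral_bound[OF \<open>s' \<le> t'\<close> cont M] by simp
    qed
    show ?thesis
    proof (cases "0 \<le> s")
      case True
      then show ?thesis using pos that by simp
    next
      case False
      have "norm (\<Phi> u t - \<Phi> u s) = norm (\<Phi> u (max t 0) - \<Phi> u 0)"
        using False \<Phi>_early by (auto simp: max_def)
      also have "\<dots> \<le> M * (max t 0 - 0)" by (rule pos) auto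
      also have "\<dots> \<le> M * (t - s)"
        using False \<open>0 \<le> M\<close> \<open>s \<le> t\<close> by (intro mult_left_mono) auto
      finally show ?thesis .
    qed
  qed
  have cont_of_rate: "continuous_on UNIV u"
    if "\<And>s t. s \<le> t \<Longrightarrow> norm (u t - u s) \<le> M * (t - s)" for u :: "real \<Rightarrow> 'a"
  proof -
    have "M-lipschitz_on UNIV u"
      using that \<open>0 \<le> M\<close> by (intro lipschitz_on_leI) (auto simp: dist_norm norm_minus_commute)
    then show ?thesis by (rule lipschitz_on_continuous_on)
  qed
  have U_rate: "norm (U k t - U k s) \<le> M * (t - s)" if "s \<le> t" for k s t
    using that
  proof (induction k arbitrary: s t)
    case 0
    then show ?case using \<open>0 \<le> M\<close> by (simp add: U_def)
  next
    case (Suc k)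
    then show ?case unfolding U_Suc by (intro rate cont_of_rate) auto
  qed
  \<comment> \<open>Each further application of \<open>\<Phi>\<close> settles the values on one more interval of length \<open>h\<close>.\<close>
  have stable: "\<forall>t \<le> real k * h. U (Suc k) t = U k t" for k
  proof (induction k)
    case 0
    show ?case using \<Phi>_early unfolding U_Suc by (simp add: U_def)
  next
    case (Suc k)
    have "integral {0..t} (\<lambda>s. G (U (Suc k) (s - h))) = integral {0..t} (\<lambda>s. G (U k (s - h)))"
      if "t \<le> real (Suc k) * h" for t
    proof (rule integral_cong)
      fix s assume "s \<in> {0..t}"
      then have "s - h \<le> real k * h"
        using that by (simp add: algebra_simps)
      then show "G (U (Suc k) (s - h)) = G (U k (s - h))" using Suc.IH by simp
    qed
    then show ?case
      unfolding U_Suc[of "Suc k"] U_Suc[of k] by (auto simp: \<Phi>_def U_Suc)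
  qed
  obtain k where "T / h \<le> real k" using real_arch_simple by blast
  then have "T \<le> real k * h" using \<open>0 < h\<close> by (simp add: field_simps)
  then have "\<forall>t\<le>T. U k t = \<Phi> (U k) t"
    using stable[of k] U_Suc by (metis order_trans)
  then show ?thesis
    using U_rate unfolding \<Phi>_def by blast
qed

text \<open>
  The delayed solutions share the Lipschitz constant \<open>M\<close>, so Arzela-Ascoli gives a uniformly convergent
  subsequence as the delay tends to \<open>0\<close>. Dominated convergence passes to the limit in the integral
  equation; the delay is harmless since it changes the argument of \<open>G\<close> by at most \<open>M h\<close>.
\<close>

theorem bounded_peano:
  fixes G :: "'a::euclidean_space \<Rightarrow> 'a"
  assumes G: "continuous_on UNIV G" and M: "\<And>z. norm (G z) \<le> M"
  shows "\<exists>x. x 0 = z\<^sub>0 \<and> solves_on G 0 T x"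
proof (cases "0 \<le> T")
  case False
  then show ?thesis by (intro exI[of _ "\<lambda>_. z\<^sub>0"]) (simp add: solves_on_def)
next
  case True
  have "0 \<le> M" using M[of 0] norm_ge_zero order_trans by blast
  define h where "h n = 1 / real (Suc n)" for n
  have h_pos: "0 < h n" for n by (simp add: h_def)
  have "\<forall>n. \<exists>u. (\<forall>s t. s \<le> t \<longrightarrow> norm (u t - u s) \<le> M * (t - s)) \<and>
             (\<forall>t\<le>T. u t = z\<^sub>0 + integral {0..t} (\<lambda>s. G (u (s - h n))))"
    using delayed_solution_exists[OF G M h_pos] by blast
  then obtain u where rate: "\<And>n s t. s \<le> t \<Longrightarrow> norm (u n t - u n s) \<le> M * (t - s)"
    and eq: "\<And>n t. t \<le> T \<Longrightarrow> u n t = z\<^sub>0 + integral {0..t} (\<lambda>s. G (u n (s - h n)))"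
    by metis
  have lip: "norm (u n t - u n s) \<le> M * \<bar>t - s\<bar>" for n s t
    using rate[of s t n] rate[of t s n] by (cases "s \<le> t") (auto simp: norm_minus_commute)
  have cont_u: "continuous_on UNIV (u n)" for n
  proof -
    have "M-lipschitz_on UNIV (u n)"
      using lip \<open>0 \<le> M\<close> by (intro lipschitz_onI) (auto simp: dist_norm)
    then show ?thesis by (rule lipschitz_on_continuous_on)
  qed
  have u0: "u n 0 = z\<^sub>0" for n using eq[of 0 n] True by simp
  have bound: "norm (u n t) \<le> norm z\<^sub>0 + M * T" if "t \<in> {0..T}" for n t
  proof -
    have "norm (u n t) \<le> norm z\<^sub>0 + norm (u n t - u n 0)"
      using norm_triangle_ineq[of "u n 0" "u n t - u n 0"] by (simp add: u0)
    also have "norm (u n t - u n 0) \<le> M * T"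
      using rate[of 0 t n] that \<open>0 \<le> M\<close> mult_left_mono[of t T M] by auto
    finally show ?thesis by simp
  qed
  have equicont: "\<exists>d. 0 < d \<and> (\<forall>n s. s \<in> {0..T} \<and> norm (t - s) < d \<longrightarrow> norm (u n t - u n s) < e)"
    if "0 < e" for t e :: real
  proof (intro exI conjI allI impI)
    show "0 < e / (M + 1)" using that \<open>0 \<le> M\<close> by simp
    fix n s assume "s \<in> {0..T} \<and> norm (t - s) < e / (M + 1)"
    then have "(M + 1) * \<bar>t - s\<bar> < e"
      using \<open>0 \<le> M\<close> by (simp add: pos_less_divide_eq mult.commute)
    moreover have "norm (u n t - u n s) \<le> (M + 1) * \<bar>t - s\<bar>"
      using lip[where n = n and t = t and s = s] by (simp add: algebra_simps)
    ultimately show "norm (u n t - u n s) < e" by linarith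
  qed
  obtain x k where cont_x: "continuous_on {0..T} x" and k: "strict_mono (k :: nat \<Rightarrow> nat)"
    and unif: "\<And>e. 0 < e \<Longrightarrow> \<exists>N. \<forall>n t. n \<ge> N \<and> t \<in> {0..T} \<longrightarrow> norm (u (k n) t - x t) < e"
    by (rule Arzela_Ascoli[of "{0..T}" u "norm z\<^sub>0 + M * T"]) (use bound equicont in auto)
  have conv: "(\<lambda>n. u (k n) t) \<longlonglongrightarrow> x t" if "t \<in> {0..T}" for t
    using unif that unfolding LIMSEQ_iff by blast
  have h_lim: "(\<lambda>n. h (k n)) \<longlonglongrightarrow> 0"
    using LIMSEQ_subseq_LIMSEQ[OF LIMSEQ_inverse_real_of_nat k]
    by (simp add: h_def o_def inverse_eq_divide)
  have conv_delayed: "(\<lambda>n. u (k n) (t - h (k n))) \<longlonglongrightarrow> x t" if "t \<in> {0..T}" for t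
  proof -
    have "(\<lambda>n. u (k n) (t - h (k n)) - u (k n) t) \<longlonglongrightarrow> 0"
    proof (rule Lim_null_comparison)
      show "\<forall>\<^sub>F n in sequentially. norm (u (k n) (t - h (k n)) - u (k n) t) \<le> M * h (k n)"
        using lip[where t = "t - h (k n)" and s = t for n] h_pos
        by (intro always_eventually allI) (metis abs_minus_cancel abs_of_pos add_diff_cancel_left' diff_add_cancel minus_diff_eq)
      show "(\<lambda>n. M * h (k n)) \<longlonglongrightarrow> 0"
        using tendsto_mult_right_zero[OF h_lim] by simp
    qed
    from tendsto_add[OF this conv[OF that]] show ?thesis by simp
  qed
  have GC: "isCont G z" for z using G continuous_on_eq_continuous_at by blast
  have x_eq: "x t = z\<^sub>0 + integral {0..t} (\<lambda>s. G (x s))" if t: "t \<in> {0..T}" for t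
  proof -
    have "(\<lambda>n. integral {0..t} (\<lambda>s. G (u (k n) (s - h (k n))))) \<longlonglongrightarrow> integral {0..t} (\<lambda>s. G (x s))"
    proof (rule dominated_convergence(2))
      show "(\<lambda>s. G (u (k n) (s - h (k n)))) integrable_on {0..t}" for n
        by (intro integrable_continuous_real)
          (auto intro!: continuous_on_compose2[OF G continuous_on_compose2[OF cont_u]] continuous_intros)
      show "(\<lambda>_. M) integrable_on {0..t}" by (simp add: integrable_const_ivl)
      show "norm (G (u (k n) (s - h (k n)))) \<le> M" for n s by (rule M)
      show "(\<lambda>n. G (u (k n) (s - h (k n)))) \<longlonglongrightarrow> G (x s)" if "s \<in> {0..t}" for s
        by (rule isCont_tendsto_compose[OF GC conv_delayed]) (use that t in auto)
    qed
    then have "(\<lambda>n. u (k n) t) \<longlonglongrightarrow> z\<^sub>0 + integral {0..t} (\<lambda>s. G (x s))"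
      using eq[of t] t by (simp add: tendsto_add)
    with conv[OF t] show ?thesis by (rule LIMSEQ_unique)
  qed
  have cont_Gx: "continuous_on {0..T} (\<lambda>s. G (x s))"
    by (rule continuous_on_compose2[OF G cont_x]) simp
  have "(x has_vector_derivative G (x t)) (at t within {0..T})" if t: "t \<in> {0..T}" for t
  proof (rule has_vector_derivative_transform[OF t])
    show "((\<lambda>t. z\<^sub>0 + integral {0..t} (\<lambda>s. G (x s))) has_vector_derivative G (x t)) (at t within {0..T})"
      using integral_has_vector_derivative[OF cont_Gx t]
      by (auto intro!: derivative_eq_intros)
  qed (use x_eq in auto)
  moreover have "x 0 = z\<^sub>0" using x_eq[of 0] True by simp
  ultimately show ?thesis unfolding solves_on_def by blast
qed

section \<open>Global flows of dissipative fields\<close>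

text \<open>
  Composing \<open>F\<close> with the radial retraction \<open>p\<close> onto a ball around \<open>c\<close> gives a bounded field. It is still
  dissipative because \<open>p z - c\<close> is a positive multiple of \<open>z - c\<close>, so its solutions stay in the ball,
  where \<open>p\<close> is the identity.
\<close>

theorem dissipative_solution_exists:
  fixes F :: "'a::euclidean_space \<Rightarrow> 'a"
  assumes F: "continuous_on UNIV F" and diss: "dissipative_about c F"
  shows "\<exists>x. x 0 = z\<^sub>0 \<and> solves_on F 0 T x"
proof -
  \<comment> \<open>The summand \<open>1\<close> keeps the radius positive when \<open>z\<^sub>0 = c\<close>.\<close>
  define R where "R = norm (z\<^sub>0 - c) + 1"
  have "R > 0" by (simp add: R_def add_nonneg_pos)
  define \<rho> where "\<rho> z = R / max R (norm (z - c))" for z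
  have \<rho>: "0 < \<rho> z" for z using \<open>R > 0\<close> by (simp add: \<rho>_def)
  define p where "p z = c + \<rho> z *\<^sub>R (z - c)" for z
  define G where "G z = F (p z)" for z
  have cont_p: "continuous_on UNIV p"
    unfolding p_def \<rho>_def using \<open>R > 0\<close> by (intro continuous_intros) auto
  have p_cball: "p z \<in> cball c R" for z
  proof -
    have "norm (p z - c) = R * (norm (z - c) / max R (norm (z - c)))"
      using \<open>R > 0\<close> by (simp add: p_def \<rho>_def)
    also have "\<dots> \<le> R * 1"
      using \<open>R > 0\<close> by (intro mult_left_mono) (auto simp: divide_le_eq)
    finally show ?thesis by (simp add: dist_norm norm_minus_commute)
  qed
  have p_id: "p z = z" if "norm (z - c) \<le> R" for z
    using that \<open>R > 0\<close> by (simp add: p_def \<rho>_def max_def)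
  have cont_G: "continuous_on UNIV G"
    unfolding G_def by (rule continuous_on_compose2[OF F cont_p]) simp
  have "compact (F ` cball c R)"
    by (rule compact_continuous_image[OF continuous_on_subset[OF F]]) auto
  then obtain M where M: "\<And>z. z \<in> F ` cball c R \<Longrightarrow> norm z \<le> M"
    using compact_imp_bounded bounded_iff by metis
  have bound: "norm (G z) \<le> M" for z
    using M p_cball by (auto simp: G_def)
  have "inner (z - c) (G z) \<le> 0" for z
  proof -
    have "\<rho> z * inner (z - c) (G z) = inner (p z - c) (F (p z))"
      by (simp add: p_def G_def)
    also have "\<dots> \<le> 0" using diss by (simp add: dissipative_about_def)
    finally show ?thesis using \<rho>[of z] by (simp add: mult_le_0_iff)
  qed
  then have diss_G: "dissipative_about c G" by (simp add: dissipative_about_def)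
  obtain x where x: "x 0 = z\<^sub>0" "solves_on G 0 T x"
    using bounded_peano[OF cont_G bound] by blast
  have "G (x t) = F (x t)" if "t \<in> {0..T}" for t
  proof -
    have "norm (x t - c) \<le> norm (z\<^sub>0 - c)"
      using dissipative_distance_decreasing[OF diss_G solves_on_subinterval[OF x(2)], of 0 t] that x(1)
      by simp
    then show ?thesis by (simp add: G_def p_id R_def)
  qed
  then have "solves_on F 0 T x" using x(2) by (simp add: solves_on_def)
  with x(1) show ?thesis by blast
qed

lemma ivp_solution_solves_on:
  assumes "ivp_solution F z\<^sub>0 x"
  shows "solves_on F 0 T x"
  using assms unfolding ivp_solution_def solves_on_def
  by (auto intro: has_vector_derivative_within_subset[where S = "{0..}"])

text \<open>
  By uniqueness the solutions on \<open>[0, n]\<close> extend one another, and at time \<open>t\<close> any of them with \<open>n \<ge> t\<close>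
  can be used to read off the global solution. For the derivative at \<open>t\<close> one takes \<open>n > t\<close>, so that
  \<open>[0, n]\<close> is a neighbourhood of \<open>t\<close> in \<open>[0, \<infinity>)\<close>.
\<close>

theorem dissipative_ivp_well_posed:
  fixes F :: "'a::euclidean_space \<Rightarrow> 'a"
  assumes F: "continuous_on UNIV F" and diss: "dissipative_about c F"
    and lip: "\<And>z. z \<noteq> c \<Longrightarrow> \<exists>\<delta>>0. \<exists>L. L-lipschitz_on (cball z \<delta>) F"
  shows "\<exists>x. ivp_solution F z\<^sub>0 x \<and> (\<forall>y. ivp_solution F z\<^sub>0 y \<longrightarrow> (\<forall>t\<ge>0. y t = x t))"
proof -
  have unique: "x b = y b"
    if "solves_on F 0 b x" "solves_on F 0 b y" "0 \<le> b" "x 0 = y 0" for x y b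
    using dissipative_solutions_unique[OF diss _ that] lip by blast
  have "\<forall>n. \<exists>x. x 0 = z\<^sub>0 \<and> solves_on F 0 (real n) x"
    using dissipative_solution_exists[OF F diss] by blast
  then obtain X where X0: "\<And>n. X n 0 = z\<^sub>0" and X: "\<And>n. solves_on F 0 (real n) (X n)"
    by metis
  define x where "x t = X (nat \<lceil>t\<rceil>) t" for t
  have x_eq: "x t = X n t" if t: "t \<in> {0..real n}" for n t
  proof -
    have "t \<le> real (nat \<lceil>t\<rceil>)" by linarith
    with t have "solves_on F 0 t (X (nat \<lceil>t\<rceil>))" "solves_on F 0 t (X n)"
      using solves_on_subinterval[OF X] by auto
    then have "X (nat \<lceil>t\<rceil>) t = X n t"
      by (rule unique) (use t X0 in auto)
    then show ?thesis by (simp add: x_def)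
  qed
  have "(x has_vector_derivative F (x t)) (at t within {0..})" if "0 \<le> t" for t
  proof -
    obtain n where n: "t < real n" using reals_Archimedean2 by blast
    have t: "t \<in> {0..real n}" using n \<open>0 \<le> t\<close> by simp
    have "(X n has_vector_derivative F (x t)) (at t within {0..real n})"
      using X[of n] t x_eq[OF t] by (simp add: solves_on_def)
    with t x_eq have "(x has_vector_derivative F (x t)) (at t within {0..real n})"
      by (rule has_vector_derivative_transform)
    moreover have "at t within {0..real n} = at t within {0..}"
      using n by (intro at_within_nhd[of t "{..<real n}"]) auto
    ultimately show ?thesis by simp
  qed
  moreover have "x 0 = z\<^sub>0" using x_eq[of 0 0] X0 by simp
  ultimately have x: "ivp_solution F z\<^sub>0 x" by (simp add: ivp_solution_def)
  have "y t = x t" if "ivp_solution F z\<^sub>0 y" "0 \<le> t" for y t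
    by (rule unique[OF ivp_solution_solves_on[OF that(1)] ivp_solution_solves_on[OF x] \<open>0 \<le> t\<close>])
      (use that x in \<open>simp add: ivp_solution_def\<close>)
  with x show ?thesis by blast
qed

section \<open>Power rescaling of a vector\<close>

text \<open>
  The radial map that turns a vector of norm \<open>r\<close> into one of norm \<open>r\<^bsup>\<alpha>\<^esup>\<close> in the same direction. At
  \<open>v = 0\<close> its value is \<open>0\<close>, which matches the convention that the gain vanishes there.
\<close>

definition power_scale :: "real \<Rightarrow> 'a::real_normed_vector \<Rightarrow> 'a" where
  "power_scale \<alpha> v = norm v powr (\<alpha> - 1) *\<^sub>R v"

lemma continuous_on_power_scale:
  assumes "0 < \<alpha>"
  shows "continuous_on UNIV (power_scale \<alpha> :: 'a::real_normed_vector \<Rightarrow> 'a)"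
proof -
  have "isCont (power_scale \<alpha>) v" for v :: 'a
  proof (cases "v = 0")
    case True
    have norm_eq: "norm (power_scale \<alpha> w) = norm w powr \<alpha>" for w :: 'a
      by (cases "w = 0") (simp_all add: power_scale_def powr_mult_base mult.commute[of _ "norm w"])
    have "((\<lambda>w::'a. norm w powr \<alpha>) \<longlongrightarrow> norm (0::'a) powr \<alpha>) (at 0)"
      using assms by (intro tendsto_powr' tendsto_intros) auto
    then have "(power_scale \<alpha> \<longlongrightarrow> (0::'a)) (at 0)"
      using assms by (simp add: norm_eq flip: tendsto_norm_zero_iff[of "power_scale \<alpha>"])
    then show ?thesis by (simp add: True isCont_def power_scale_def)
  next
    case False
    then show ?thesis unfolding power_scale_def by (intro continuous_intros) auto
  qed
  then show ?thesis by (simp add: continuous_at_imp_continuous_on)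
qed

lemma powr_bounded_on_Icc:
  fixes m M a :: real
  assumes "0 < m"
  shows "\<exists>B>0. \<forall>r\<in>{m..M}. r powr a \<le> B"
proof -
  have "bounded ((\<lambda>r. r powr a) ` {m..M})"
    using assms by (intro compact_imp_bounded compact_continuous_image continuous_intros) auto
  then obtain B where "0 < B" "\<forall>y\<in>(\<lambda>r. r powr a) ` {m..M}. norm y \<le> B"
    unfolding bounded_pos by blast
  then show ?thesis by (intro exI[of _ B]) simp
qed

lemma powr_lipschitz_on_Icc:
  fixes m M a :: real
  assumes "0 < m"
  shows "\<exists>C. C-lipschitz_on {m..M} (\<lambda>r. r powr a)"
proof -
  obtain B where "0 < B" and B: "\<forall>r\<in>{m..M}. r powr (a - 1) \<le> B"
    using powr_bounded_on_Icc[OF assms] by blast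
  have "(\<bar>a\<bar> * B)-lipschitz_on {m..M} (\<lambda>r. r powr a)"
  proof (rule lipschitz_onI)
    fix r s assume rs: "r \<in> {m..M}" "s \<in> {m..M}"
    have "norm (r powr a - s powr a) \<le> \<bar>a\<bar> * B * norm (r - s)"
    proof (rule field_differentiable_bound[OF _ _ _ rs])
      show "((\<lambda>r. r powr a) has_field_derivative a * r powr (a - 1)) (at r within {m..M})"
        if "r \<in> {m..M}" for r
        by (rule has_field_derivative_at_within[OF has_real_derivative_powr]) (use that assms in auto)
      show "norm (a * r powr (a - 1)) \<le> \<bar>a\<bar> * B" if "r \<in> {m..M}" for r
        using B that by (simp add: abs_mult mult_left_mono)
    qed simp
    then show "dist (r powr a) (s powr a) \<le> \<bar>a\<bar> * B * dist r s" by (simp add: dist_norm)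
  qed (use \<open>0 < B\<close> in simp)
  then show ?thesis by blast
qed

text \<open>
  Both factors of \<open>\<parallel>v\<parallel>\<^bsup>\<alpha> - 1\<^esup> v\<close> are bounded and Lipschitz as long as the norm stays in a compact interval
  away from \<open>0\<close>.
\<close>

lemma power_scale_lipschitz_on_annulus:
  assumes "0 < m"
  shows "\<exists>C. C-lipschitz_on {v :: 'a::real_normed_vector. norm v \<in> {m..M}} (power_scale \<alpha>)"
proof -
  obtain C where C: "C-lipschitz_on {m..M} (\<lambda>r. r powr (\<alpha> - 1))"
    using powr_lipschitz_on_Icc[OF assms] by blast
  have "C \<ge> 0" using C by (rule lipschitz_on_nonneg)
  obtain B where "0 < B" and B: "\<forall>r\<in>{m..M}. r powr (\<alpha> - 1) \<le> B"
    using powr_bounded_on_Icc[OF assms] by blast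
  have "(C * \<bar>M\<bar> + B)-lipschitz_on {v :: 'a. norm v \<in> {m..M}} (power_scale \<alpha>)"
  proof (rule lipschitz_onI)
    fix v w :: 'a
    assume "v \<in> {v. norm v \<in> {m..M}}" "w \<in> {v. norm v \<in> {m..M}}"
    then have v: "norm v \<in> {m..M}" and w: "norm w \<in> {m..M}" by auto
    let ?g = "\<lambda>v::'a. norm v powr (\<alpha> - 1)"
    have "power_scale \<alpha> v - power_scale \<alpha> w = (?g v - ?g w) *\<^sub>R v + ?g w *\<^sub>R (v - w)"
      by (simp add: power_scale_def algebra_simps)
    then have "norm (power_scale \<alpha> v - power_scale \<alpha> w) \<le> \<bar>?g v - ?g w\<bar> * norm v + ?g w * norm (v - w)"
      using norm_triangle_ineq[of "(?g v - ?g w) *\<^sub>R v" "?g w *\<^sub>R (v - w)"] by simp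
    also have "\<dots> \<le> (C * norm (v - w)) * \<bar>M\<bar> + B * norm (v - w)"
    proof (intro add_mono mult_mono)
      have "\<bar>?g v - ?g w\<bar> \<le> C * \<bar>norm v - norm w\<bar>"
        using lipschitz_onD[OF C v w] by (simp add: dist_real_def)
      also have "\<dots> \<le> C * norm (v - w)"
        using \<open>C \<ge> 0\<close> norm_triangle_ineq3 by (intro mult_left_mono) auto
      finally show "\<bar>?g v - ?g w\<bar> \<le> C * norm (v - w)" .
    qed (use v w B \<open>0 < B\<close> \<open>0 \<le> C\<close> in auto)
    finally show "dist (power_scale \<alpha> v) (power_scale \<alpha> w) \<le> (C * \<bar>M\<bar> + B) * dist v w"
      by (simp add: dist_norm algebra_simps)
  qed (use \<open>0 < B\<close> \<open>C \<ge> 0\<close> in simp)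
  then show ?thesis by blast
qed

text \<open>
  The radius \<open>\<delta>\<close> is chosen so that \<open>X\<close> varies by at most half of \<open>\<parallel>X z\<parallel>\<close> on the ball; its values then
  lie in the annulus where the norm is between \<open>\<parallel>X z\<parallel> / 2\<close> and \<open>3 \<parallel>X z\<parallel> / 2\<close>.
\<close>

lemma power_scale_compose_locally_lipschitz:
  fixes X :: "'a::metric_space \<Rightarrow> 'b::real_normed_vector"
  assumes "0 < d" "L-lipschitz_on (cball z d) X" "X z \<noteq> 0"
  shows "\<exists>\<delta>>0. \<delta> \<le> d \<and> (\<exists>C. C-lipschitz_on (cball z \<delta>) (\<lambda>x. power_scale \<alpha> (X x)))"
proof -
  define m where "m = norm (X z) / 2"
  have "0 < m" using assms by (simp add: m_def)
  have "L \<ge> 0" using assms(2) by (rule lipschitz_on_nonneg)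
  define \<delta> where "\<delta> = min d (m / (L + 1))"
  have \<delta>: "0 < \<delta>" "\<delta> \<le> d" "L * \<delta> \<le> m"
  proof -
    show "0 < \<delta>" "\<delta> \<le> d" using \<open>0 < d\<close> \<open>0 < m\<close> \<open>L \<ge> 0\<close> by (auto simp: \<delta>_def)
    have "\<delta> \<le> m / (L + 1)" by (simp add: \<delta>_def)
    then have "(L + 1) * \<delta> \<le> m"
      using \<open>L \<ge> 0\<close> by (simp add: pos_le_divide_eq mult.commute)
    then show "L * \<delta> \<le> m" using \<open>0 < \<delta>\<close> by (simp add: algebra_simps)
  qed
  have X: "L-lipschitz_on (cball z \<delta>) X"
    using assms(2) by (rule lipschitz_on_subset) (use \<delta> in auto)
  obtain C where C: "C-lipschitz_on {v :: 'b. norm v \<in> {m..3 * m}} (power_scale \<alpha>)"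
    using power_scale_lipschitz_on_annulus[OF \<open>0 < m\<close>] by blast
  have "X ` cball z \<delta> \<subseteq> {v. norm v \<in> {m..3 * m}}"
  proof clarsimp
    fix x assume x: "dist z x \<le> \<delta>"
    have "dist (X x) (X z) \<le> L * dist x z"
      using lipschitz_onD[OF X, of x z] x \<delta> by simp
    also have "\<dots> \<le> L * \<delta>" using x \<open>L \<ge> 0\<close> by (intro mult_left_mono) (auto simp: dist_commute)
    finally have "norm (X x - X z) \<le> m" using \<delta> by (simp add: dist_norm)
    moreover have "norm (X z) = 2 * m" by (simp add: m_def)
    ultimately show "m \<le> norm (X x) \<and> norm (X x) \<le> 3 * m"
      using norm_triangle_ineq3[of "X x" "X z"] by linarith
  qed
  then have "C-lipschitz_on (X ` cball z \<delta>) (power_scale \<alpha>)"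
    using C lipschitz_on_subset by blast
  from lipschitz_on_compose2[OF X this] \<delta> show ?thesis by blast
qed

section \<open>Well-posedness of the rescaled flow\<close>

text \<open>
  As \<open>1 / r powr (1 - \<alpha>) = r powr (\<alpha> - 1)\<close>, the right-hand side is a combination of two power
  rescalings of \<open>X\<close>; it inherits dissipativity about \<open>xbar\<close> from \<open>X\<close> because the gain is nonnegative,
  and \<open>X z \<noteq> 0\<close> for \<open>z \<noteq> xbar\<close> makes it locally Lipschitz there.
\<close>

theorem proposition2:
  fixes X :: "'a::euclidean_space \<Rightarrow> 'a" and xbar :: 'a
    and \<kappa>\<^sub>1 \<kappa>\<^sub>2 \<alpha>\<^sub>1 \<alpha>\<^sub>2 :: real
  assumes "local_lipschitz (UNIV :: real set) UNIV (\<lambda>_. X)"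
    and "X xbar = 0"
    and "\<And>x. x \<noteq> xbar \<Longrightarrow> inner (x - xbar) (X x) > 0"
    and "\<kappa>\<^sub>1 > 0" and "\<kappa>\<^sub>2 > 0"
    and "0 < \<alpha>\<^sub>1" and "\<alpha>\<^sub>1 < 1" and "\<alpha>\<^sub>2 > 1"
  defines "F \<equiv> \<lambda>x. - (gain \<kappa>\<^sub>1 \<kappa>\<^sub>2 \<alpha>\<^sub>1 \<alpha>\<^sub>2 X x *\<^sub>R X x)"
  shows "continuous_on UNIV F \<and>
    (\<forall>x\<^sub>0. \<exists>x. ivp_solution F x\<^sub>0 x \<and>
       (\<forall>y. ivp_solution F x\<^sub>0 y \<longrightarrow> (\<forall>t\<ge>0. y t = x t)))"
proof -
  have inv_powr: "1 / r powr (1 - \<alpha>) = r powr (\<alpha> - 1)" for r \<alpha> :: real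
    by (metis minus_diff_eq powr_minus_divide)
  have F_eq: "F = (\<lambda>x. - (\<kappa>\<^sub>1 *\<^sub>R power_scale \<alpha>\<^sub>1 (X x) + \<kappa>\<^sub>2 *\<^sub>R power_scale \<alpha>\<^sub>2 (X x)))"
    by (auto simp: F_def gain_def power_scale_def inv_powr algebra_simps)
  have cont_X: "continuous_on UNIV X"
    using local_lipschitz_continuous_on[OF assms(1)] by simp
  have cont_scale: "continuous_on UNIV (\<lambda>x. power_scale \<alpha> (X x))" if "0 < \<alpha>" for \<alpha>
    by (rule continuous_on_compose2[OF continuous_on_power_scale[OF that] cont_X]) simp
  have cont_F: "continuous_on UNIV F"
    unfolding F_eq using assms by (intro continuous_intros cont_scale) auto
  have "inner (x - xbar) (F x) \<le> 0" for x
  proof -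
    have "0 \<le> inner (x - xbar) (X x)"
      using assms(3)[of x] by (cases "x = xbar") auto
    moreover have "0 \<le> gain \<kappa>\<^sub>1 \<kappa>\<^sub>2 \<alpha>\<^sub>1 \<alpha>\<^sub>2 X x"
      using assms by (simp add: gain_def)
    ultimately show ?thesis by (simp add: F_def)
  qed
  then have diss: "dissipative_about xbar F" by (simp add: dissipative_about_def)
  have lip: "\<exists>\<delta>>0. \<exists>L. L-lipschitz_on (cball z \<delta>) F" if "z \<noteq> xbar" for z
  proof -
    have "X z \<noteq> 0" using assms(3)[OF that] by auto
    obtain d L where "0 < d" and L: "L-lipschitz_on (cball z d) X"
      using local_lipschitzE[OF assms(1), of 0 z] by (metis Int_UNIV_right UNIV_I centre_in_cball less_imp_le)
    obtain \<delta>\<^sub>1 C\<^sub>1 where 1: "0 < \<delta>\<^sub>1" "\<delta>\<^sub>1 \<le> d" "C\<^sub>1-lipschitz_on (cball z \<delta>\<^sub>1) (\<lambda>x. power_scale \<alpha>\<^sub>1 (X x))"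
      using power_scale_compose_locally_lipschitz[OF \<open>0 < d\<close> L \<open>X z \<noteq> 0\<close>] by metis
    obtain \<delta>\<^sub>2 C\<^sub>2 where 2: "0 < \<delta>\<^sub>2" "\<delta>\<^sub>2 \<le> d" "C\<^sub>2-lipschitz_on (cball z \<delta>\<^sub>2) (\<lambda>x. power_scale \<alpha>\<^sub>2 (X x))"
      using power_scale_compose_locally_lipschitz[OF \<open>0 < d\<close> L \<open>X z \<noteq> 0\<close>] by metis
    define \<delta> where "\<delta> = min \<delta>\<^sub>1 \<delta>\<^sub>2"
    have "C\<^sub>1-lipschitz_on (cball z \<delta>) (\<lambda>x. power_scale \<alpha>\<^sub>1 (X x))"
      using 1(3) by (rule lipschitz_on_subset) (auto simp: \<delta>_def)
    moreover have "C\<^sub>2-lipschitz_on (cball z \<delta>) (\<lambda>x. power_scale \<alpha>\<^sub>2 (X x))"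
      using 2(3) by (rule lipschitz_on_subset) (auto simp: \<delta>_def)
    ultimately have "(\<bar>\<kappa>\<^sub>1\<bar> * C\<^sub>1 + \<bar>\<kappa>\<^sub>2\<bar> * C\<^sub>2)-lipschitz_on (cball z \<delta>) F"
      unfolding F_eq by (intro lipschitz_on_minus lipschitz_on_add lipschitz_on_cmult)
    moreover have "0 < \<delta>" using 1 2 by (simp add: \<delta>_def)
    ultimately show ?thesis by blast
  qed
  show ?thesis
    using cont_F dissipative_ivp_well_posed[OF cont_F diss lip] by blast
qed

end
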